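(* Let $N$ be a natural number such that $N$ cannot be written as a sum of two squares, and $N=2m$ for some odd integer $m$. Then $$\nu_2(N)+\sum_{1\le k<\sqrt N}\sigma_0(N-k^2)+\frac12\sigma_1(N)\equiv 0\pmod 4,$$ where the sum runs over positive integers $k<\sqrt N$.
   Context: For a positive integer $m$, $\sigma_0(m)$ is the number of positive divisors of $m$ and $\sigma_1(m)$ is the sum of the positive divisors of $m$. $\nu_2(N)$ denotes the number of partitions of $N$ in which exactly two distinct part sizes appear, i.e. the number of tuples $(n_1,\dots,n_1,n_2,\dots,n_2)$ with $n_1>n_2\ge 1$, $n_1$ appearing $k_1\ge1$ times and $n_2$ appearing $k_2\ge 1$ times, and $k_1n_1+k_2n_2=N$. *)

theory Defs
  imports Complex_Main "HOL-Library.Multiset" "HOL-Library.Real_Mod"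
begin

definition sigma0 :: "nat \<Rightarrow> nat" where
  "sigma0 m = card {d. d dvd m}"

definition sigma1 :: "nat \<Rightarrow> nat" where
  "sigma1 m = (\<Sum>d | d dvd m. d)"

text \<open>A partition of \<open>N\<close> is a finite multiset of positive integers with sum \<open>N\<close>;
  its part sizes are the elements of the underlying set.\<close>

definition nu2 :: "nat \<Rightarrow> nat" where
  "nu2 N = card {P :: nat multiset. 0 \<notin># P \<and> sum_mset P = N \<and> card (set_mset P) = 2}"

end

theory Submission
  imports Defs
begin

text \<open>
  Let \<open>T = (\<Sum>0<j<N. \<sigma>\<^sub>0(j) \<sigma>\<^sub>0(N - j))\<close>, the number of positive solutions of \<open>ab + cd = N\<close>.
  Sorting the solutions by the order of \<open>b\<close> and \<open>d\<close> gives \<open>T = 2\<nu>\<^sub>2(N) + \<sigma>\<^sub>1(N) - \<sigma>\<^sub>0(N)\<close>, the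
  solutions with \<open>b = d\<close> being counted by \<open>\<Sum>b | N. (N/b - 1)\<close>. On the other hand \<open>\<sigma>\<^sub>0(j)\<close> is
  odd exactly for squares \<open>j\<close>, and \<open>j\<close>, \<open>N - j\<close> are never both squares. So modulo 4 the term
  \<open>\<sigma>\<^sub>0(j) \<sigma>\<^sub>0(N - j)\<close> is \<open>0\<close>, \<open>\<sigma>\<^sub>0(N - j)\<close> or \<open>\<sigma>\<^sub>0(j)\<close>, according to whether neither,
  \<open>j\<close> or \<open>N - j\<close> is a square. The symmetry \<open>j \<mapsto> N - j\<close> about \<open>m = N/2\<close> improves this to
  \<open>T \<equiv> 2S + \<sigma>\<^sub>0(m)\<^sup>2 (mod 8)\<close> with \<open>S = (\<Sum>k. \<sigma>\<^sub>0(N - k\<^sup>2))\<close>. Finally \<open>\<sigma>\<^sub>0(N) = 2\<sigma>\<^sub>0(m)\<close>, and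
  \<open>S\<close> and \<open>\<sigma>\<^sub>0(m)\<close> are even.
\<close>

section \<open>Divisor counts: parity and doubling\<close>

lemma odd_sigma0_iff:
  assumes "n > 0"
  shows "odd (sigma0 n) \<longleftrightarrow> (\<exists>k. n = k\<^sup>2)"
proof -
  define L where "L = {d. d dvd n \<and> d * d < n}"
  define G where "G = {d. d dvd n \<and> d * d > n}"
  define E where "E = {d. d dvd n \<and> d * d = n}"
  have fin: "finite {d. d dvd n}" using assms by simp
  have fins: "finite L" "finite G" "finite E"
    by (rule finite_subset[OF _ fin], force simp: L_def G_def E_def)+
  \<comment> \<open>Complementary divisors pair those below the square root of \<open>n\<close> with
    those above, so only \<open>E\<close> decides the parity.\<close>
  have "bij_betw (\<lambda>d. n div d) L G"
  proof (rule bij_betw_byWitness[where f' = "\<lambda>d. n div d"])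
    show "(\<lambda>d. n div d) ` L \<subseteq> G"
      using assms by (auto simp: L_def G_def elim!: dvdE)
    show "(\<lambda>d. n div d) ` G \<subseteq> L"
      using assms by (auto simp: L_def G_def elim!: dvdE)
  qed (use assms in \<open>auto simp: L_def G_def\<close>)
  then have "card L = card G" by (rule bij_betw_same_card)
  moreover have "{d. d dvd n} = L \<union> G \<union> E" by (auto simp: L_def G_def E_def)
  moreover have "card (L \<union> G \<union> E) = card L + card G + card E"
    using fins by (subst card_Un_disjoint, simp_all, force simp: L_def G_def E_def)
      (subst card_Un_disjoint, auto simp: L_def G_def)
  ultimately have "odd (sigma0 n) \<longleftrightarrow> odd (card E)"
    by (simp add: sigma0_def)
  also have "\<dots> \<longleftrightarrow> (\<exists>k. n = k\<^sup>2)"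
  proof (cases "\<exists>k. n = k\<^sup>2")
    case True
    then obtain k where k: "n = k\<^sup>2" by blast
    have "E = {k}" by (auto simp: E_def k power2_eq_square[symmetric])
    then show ?thesis using True by simp
  next
    case False
    then have "E = {}" by (auto simp: E_def power2_eq_square)
    then show ?thesis using False by simp
  qed
  finally show ?thesis .
qed

text \<open>An odd divisor of \<open>2 * m\<close> divides \<open>m\<close>, an even one is twice a
  divisor of \<open>m\<close>; the two kinds are disjoint because \<open>m\<close> is odd.\<close>

lemma sigma0_double_odd:
  assumes "odd m"
  shows "sigma0 (2 * m) = 2 * sigma0 m"
proof -
  have "m > 0" using assms by (cases m) auto
  have "{d. d dvd 2 * m} = {d. d dvd m} \<union> (*) 2 ` {d. d dvd m}"
  proof (intro equalityI subsetI)
    fix d assume d: "d \<in> {d. d dvd 2 * m}"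
    show "d \<in> {d. d dvd m} \<union> (*) 2 ` {d. d dvd m}"
    proof (cases "even d")
      case True
      then show ?thesis using d by auto
    next
      case False
      then have "coprime d 2" by simp
      then show ?thesis using d by (simp add: coprime_dvd_mult_right_iff)
    qed
  qed auto
  moreover have "{d. d dvd m} \<inter> (*) 2 ` {d. d dvd m} = {}"
    using assms by (auto elim: dvd_trans[rotated])
  moreover have "finite {d. d dvd m}" using \<open>m > 0\<close> by simp
  ultimately show ?thesis
    by (simp add: sigma0_def card_Un_disjoint card_image inj_on_def)
qed

lemma sum_div_divisors:
  assumes "N > 0"
  shows "(\<Sum>d | d dvd N. N div d) = sigma1 N"
  unfolding sigma1_def
  by (rule sum.reindex_bij_witness[where i = "\<lambda>d. N div d" and j = "\<lambda>d. N div d"])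
    (use assms in auto)

section \<open>Counting the solutions of \<open>a * b + c * d = N\<close>\<close>

definition two_products :: "nat \<Rightarrow> (nat \<times> nat \<times> nat \<times> nat) set" where
  "two_products N = {(a, b, c, d). a > 0 \<and> b > 0 \<and> c > 0 \<and> d > 0 \<and> a * b + c * d = N}"

lemma finite_two_products: "finite (two_products N)"
proof (rule finite_subset)
  show "two_products N \<subseteq> {..N} \<times> {..N} \<times> {..N} \<times> {..N}"
  proof
    fix x assume "x \<in> two_products N"
    then obtain a b c d where x: "x = (a, b, c, d)" and *: "a > 0" "b > 0" "c > 0" "d > 0" "a * b \<le> N" "c * d \<le> N"
      by (auto simp: two_products_def)
    have "a \<le> a * b" "b \<le> a * b" "c \<le> c * d" "d \<le> c * d" using * by auto
    with * have "a \<le> N" "b \<le> N" "c \<le> N" "d \<le> N" by linarith+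
    then show "x \<in> {..N} \<times> {..N} \<times> {..N} \<times> {..N}" by (simp add: x)
  qed
qed simp

lemma card_factorizations:
  assumes "n > 0"
  shows "card {(a, b). a * b = n} = sigma0 n"
proof -
  have "bij_betw fst {(a, b). a * b = n} {d. d dvd n}"
    by (rule bij_betw_byWitness[where f' = "\<lambda>d. (d, n div d)"]) (use assms in auto)
  then show ?thesis by (simp add: sigma0_def bij_betw_same_card)
qed

lemma card_two_products:
  "card (two_products N) = (\<Sum>j\<in>{0<..<N}. sigma0 j * sigma0 (N - j))"
proof -
  define F where "F n = {(a::nat, b::nat). a * b = n}" for n :: nat
  have finF: "finite (F n)" if "n > 0" for n
  proof (rule finite_subset)
    show "F n \<subseteq> {d. d dvd n} \<times> {d. d dvd n}" by (auto simp: F_def)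
  qed (use that in auto)
  \<comment> \<open>The solutions are sorted by \<open>j = a * b\<close>; each \<open>j\<close>
    leaves independent factorizations of \<open>j\<close> and \<open>N - j\<close>.\<close>
  have "bij_betw (\<lambda>(a, b, c, d). (a * b, (a, b), (c, d))) (two_products N)
          (SIGMA j:{0<..<N}. F j \<times> F (N - j))"
    by (rule bij_betw_byWitness[where f' = "\<lambda>(j, (a, b), (c, d)). (a, b, c, d)"])
      (auto simp: two_products_def F_def intro!: Nat.gr0I)
  then have "card (two_products N) = card (SIGMA j:{0<..<N}. F j \<times> F (N - j))"
    by (rule bij_betw_same_card)
  also have "\<dots> = (\<Sum>j\<in>{0<..<N}. card (F j \<times> F (N - j)))"
    using finF by (subst card_SigmaI) auto
  also have "\<dots> = (\<Sum>j\<in>{0<..<N}. sigma0 j * sigma0 (N - j))"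
    by (intro sum.cong) (auto simp: card_cartesian_product F_def card_factorizations)
  finally show ?thesis .
qed

text \<open>A solution with \<open>b > d\<close> encodes the partition with \<open>a\<close> parts
  \<open>b\<close> and \<open>c\<close> parts \<open>d\<close>. The order on \<open>b\<close> and
  \<open>d\<close> makes the encoding unique.\<close>

lemma nu2_eq_card_two_products:
  "nu2 N = card {(a, b, c, d) \<in> two_products N. b > d}"
proof -
  let ?f = "\<lambda>(a, b, c, d). replicate_mset a b + replicate_mset c d :: nat multiset"
  let ?A = "{(a, b, c, d) \<in> two_products N. b > d}"
  let ?B = "{P :: nat multiset. 0 \<notin># P \<and> sum_mset P = N \<and> card (set_mset P) = 2}"
  have set_f: "set_mset (replicate_mset a b + replicate_mset c d) = {b, d}"
    if "a > 0" "c > 0" for a b c d :: nat using that by auto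
  have inj: "inj_on ?f ?A"
  proof (rule inj_onI)
    fix x y assume xy: "x \<in> ?A" "y \<in> ?A" "?f x = ?f y"
    obtain a b c d a' b' c' d' where x: "x = (a, b, c, d)" and y: "y = (a', b', c', d')"
      by (cases x, cases y)
    with xy have q: "(a, b, c, d) \<in> two_products N" "(a', b', c', d') \<in> two_products N"
      and lt: "d < b" "d' < b'"
      and eq: "replicate_mset a b + replicate_mset c d = replicate_mset a' b' + replicate_mset c' d'"
      by auto
    have "{b, d} = {b', d'}"
      using arg_cong[OF eq, of set_mset] q by (auto simp: two_products_def set_f simp del: set_mset_union)
    with lt have bd: "b = b'" "d = d'" by (auto simp: doubleton_eq_iff)
    \<comment> \<open>As \<open>b\<close> and \<open>d\<close> differ, their multiplicities are
      exactly \<open>a\<close> and \<open>c\<close>.\<close>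
    with arg_cong[OF eq, of "\<lambda>P. count P b"] arg_cong[OF eq, of "\<lambda>P. count P d"] lt
    show "x = y" by (simp add: x y)
  qed
  have image: "?f ` ?A = ?B"
  proof (intro equalityI subsetI)
    fix P assume "P \<in> ?f ` ?A"
    then obtain a b c d where q: "(a, b, c, d) \<in> two_products N" "d < b"
      and P: "P = replicate_mset a b + replicate_mset c d" by auto
    then have "set_mset P = {b, d}" by (auto simp: two_products_def)
    moreover have "sum_mset P = N" "b > 0" "d > 0"
      using q by (auto simp: P two_products_def)
    ultimately show "P \<in> ?B" using q(2) by auto
  next
    fix P assume P: "P \<in> ?B"
    then obtain x y where "set_mset P = {x, y}" "x \<noteq> y" by (auto simp: card_2_iff)
    then obtain b d where bd: "set_mset P = {b, d}" "d < b"
      by (metis insert_commute nat_neq_iff)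
    define a c where "a = count P b" and "c = count P d"
    have pos: "a > 0" "c > 0" using bd by (auto simp: a_def c_def)
    have P_eq: "P = replicate_mset a b + replicate_mset c d"
    proof (rule multiset_eqI)
      fix z show "count P z = count (replicate_mset a b + replicate_mset c d) z"
        using bd(2) count_eq_zero_iff[of P z] unfolding bd(1)
        by (cases "z = b"; cases "z = d") (simp_all add: a_def c_def)
    qed
    have "b > 0" "d > 0" using P bd by (auto intro!: Nat.gr0I)
    moreover have "a * b + c * d = N" using P unfolding P_eq by auto
    ultimately have "(a, b, c, d) \<in> ?A" using pos bd by (simp add: two_products_def)
    then show "P \<in> ?f ` ?A" using P_eq by force
  qed
  show ?thesis using card_image[OF inj] unfolding image nu2_def .
qed

text \<open>Here \<open>b\<close> divides \<open>N\<close> and \<open>a + c = N div b\<close>, which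
  leaves \<open>N div b - 1\<close> choices of \<open>a\<close>. Adding \<open>sigma0 N\<close>
  restores the 1 lost for each divisor.\<close>

lemma card_two_products_common_factor:
  assumes "N > 0"
  shows "card {(a, b, c, d) \<in> two_products N. b = d} + sigma0 N = sigma1 N"
proof -
  let ?E = "{(a, b, c, d) \<in> two_products N. b = d}"
  have "bij_betw (\<lambda>(a, b, c, d). (b, a)) ?E (SIGMA b:{b. b dvd N}. {0<..<N div b})"
  proof (rule bij_betw_byWitness[where f' = "\<lambda>(b, a). (a, b, N div b - a, b)"])
    show "(\<lambda>(a, b, c, d). (b, a)) ` ?E \<subseteq> (SIGMA b:{b. b dvd N}. {0<..<N div b})"
      by (auto simp: two_products_def add_mult_distrib[symmetric])
    show "(\<lambda>(b, a). (a, b, N div b - a, b)) ` (SIGMA b:{b. b dvd N}. {0<..<N div b}) \<subseteq> ?E"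
      using assms by (auto simp: two_products_def add_mult_distrib[symmetric] intro!: Nat.gr0I)
  qed (auto simp: two_products_def add_mult_distrib[symmetric])
  then have "card ?E = card (SIGMA b:{b. b dvd N}. {0<..<N div b})"
    by (rule bij_betw_same_card)
  also have "\<dots> = (\<Sum>b | b dvd N. N div b - 1)"
    using assms by (subst card_SigmaI) auto
  finally have "card ?E + sigma0 N = (\<Sum>b | b dvd N. (N div b - 1) + 1)"
    by (simp only: sum.distrib sigma0_def card_eq_sum)
  also have "\<dots> = (\<Sum>b | b dvd N. N div b)"
    using assms by (intro sum.cong refl) (auto elim!: dvdE)
  finally show ?thesis using sum_div_divisors[OF assms] by simp
qed

text \<open>Swapping the two products matches the solutions with \<open>b > d\<close> and those with
  \<open>b < d\<close>, hence the factor 2.\<close>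

lemma nu2_convolution:
  assumes "N > 0"
  shows "2 * nu2 N + sigma1 N = (\<Sum>j\<in>{0<..<N}. sigma0 j * sigma0 (N - j)) + sigma0 N"
proof -
  let ?G = "{(a, b, c, d) \<in> two_products N. b > d}"
  let ?L = "{(a, b, c, d) \<in> two_products N. b < d}"
  let ?E = "{(a, b, c, d) \<in> two_products N. b = d}"
  have fins: "finite ?G" "finite ?L" "finite ?E"
    by (rule finite_subset[OF _ finite_two_products[of N]], force)+
  have "bij_betw (\<lambda>(a, b, c, d). (c, d, a, b)) ?G ?L"
    by (rule bij_betw_byWitness[where f' = "\<lambda>(a, b, c, d). (c, d, a, b)"])
      (auto simp: two_products_def)
  then have "card ?G = card ?L" by (rule bij_betw_same_card)
  moreover have "two_products N = ?G \<union> ?L \<union> ?E" by auto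
  moreover have "card (?G \<union> ?L \<union> ?E) = card ?G + card ?L + card ?E"
    using fins by (subst card_Un_disjoint, simp_all, force)
      (subst card_Un_disjoint, auto)
  ultimately have "card (two_products N) = 2 * nu2 N + card ?E"
    by (simp add: nu2_eq_card_two_products)
  then show ?thesis
    using card_two_products_common_factor[OF assms] card_two_products[of N] by simp
qed

section \<open>The convolution modulo 8\<close>

lemma sum_symmetric_about_middle:
  fixes g :: "nat \<Rightarrow> int"
  assumes "m > 0" and sym: "\<And>j. 0 < j \<Longrightarrow> j < m \<Longrightarrow> g (2 * m - j) = g j"
  shows "(\<Sum>j\<in>{0<..<2 * m}. g j) = 2 * (\<Sum>j\<in>{0<..<m}. g j) + g m"
proof -
  have "{0<..<2 * m} = insert m ({0<..<m} \<union> {m<..<2 * m})" using assms(1) by auto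
  then have "(\<Sum>j\<in>{0<..<2 * m}. g j) = g m + ((\<Sum>j\<in>{0<..<m}. g j) + (\<Sum>j\<in>{m<..<2 * m}. g j))"
    by (simp add: sum.union_disjoint)
  moreover have "(\<Sum>j\<in>{m<..<2 * m}. g j) = (\<Sum>j\<in>{0<..<m}. g j)"
    by (rule sum.reindex_bij_witness[where i = "\<lambda>j. 2 * m - j" and j = "\<lambda>j. 2 * m - j"])
      (auto simp: sym[symmetric])
  ultimately show ?thesis by simp
qed

lemma sum_squares_below:
  fixes f :: "nat \<Rightarrow> int"
  shows "(\<Sum>j\<in>{0<..<N}. if \<exists>k. j = k\<^sup>2 then f j else 0) = (\<Sum>k | 1 \<le> k \<and> k\<^sup>2 < N. f (k\<^sup>2))"
proof -
  have "(\<Sum>j\<in>{0<..<N}. if \<exists>k. j = k\<^sup>2 then f j else 0)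
      = (\<Sum>j\<in>{j \<in> {0<..<N}. \<exists>k. j = k\<^sup>2}. f j)"
    by (rule sum.inter_filter[symmetric]) simp
  also have "{j \<in> {0<..<N}. \<exists>k. j = k\<^sup>2} = (\<lambda>k. k\<^sup>2) ` {k. 1 \<le> k \<and> k\<^sup>2 < N}"
    by (auto simp: Suc_le_eq intro!: Nat.gr0I)
  also have "(\<Sum>j\<in>\<dots>. f j) = (\<Sum>k | 1 \<le> k \<and> k\<^sup>2 < N. f (k\<^sup>2))"
    by (subst sum.reindex) (auto simp: inj_on_def)
  finally show ?thesis .
qed

text \<open>After subtracting the contributions of squares, every term is divisible by 4. Pairing
  \<open>j\<close> with \<open>N - j\<close> doubles the sum over \<open>j < m\<close>, which gives
  8; only the unpaired middle term at \<open>m\<close> remains.\<close>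

lemma convolution_mod_8:
  fixes m :: nat
  defines "N \<equiv> 2 * m"
  assumes "m > 0" and nsq: "\<And>a b :: nat. N \<noteq> a\<^sup>2 + b\<^sup>2"
  shows "8 dvd (\<Sum>j\<in>{0<..<N}. int (sigma0 j) * int (sigma0 (N - j)))
           - 2 * (\<Sum>k | 1 \<le> k \<and> k\<^sup>2 < N. int (sigma0 (N - k\<^sup>2))) - (int (sigma0 m))\<^sup>2"
proof -
  define s where "s j = int (sigma0 j)" for j
  \<comment> \<open>\<open>q j\<close> is the residue of the product modulo 4 when \<open>j\<close>
    is a square; \<open>q (N - j)\<close> does the same when \<open>N - j\<close> is one.\<close>
  define q where "q j = (if \<exists>k. j = k\<^sup>2 then s (N - j) else 0)" for j :: nat
  define g where "g j = s j * s (N - j) - q j - q (N - j)" for j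
  have odd_s: "odd (s j) \<longleftrightarrow> (\<exists>k. j = k\<^sup>2)" if "j > 0" for j
    using odd_sigma0_iff[OF that] by (simp add: s_def)
  have dvd_g: "4 dvd g j" if j: "0 < j" "j < N" for j
  proof -
    \<comment> \<open>The difference is \<open>(x - 1) * y\<close>, a product of two even
      numbers.\<close>
    have aux: "4 dvd x * y - y" if "odd x" "even y" for x y :: int
      using that by (auto elim!: oddE evenE simp: algebra_simps)
    have sq: "odd (s j) \<longleftrightarrow> (\<exists>k. j = k\<^sup>2)" "odd (s (N - j)) \<longleftrightarrow> (\<exists>k. N - j = k\<^sup>2)"
      using j by (intro odd_s; simp)+
    have not_both: "\<not> ((\<exists>k. j = k\<^sup>2) \<and> (\<exists>k. N - j = k\<^sup>2))"
      using nsq j by (metis le_add_diff_inverse less_imp_le)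
    have NN: "N - (N - j) = j" using j by simp
    consider "odd (s j)" "even (s (N - j))" | "even (s j)" "odd (s (N - j))"
      | "even (s j)" "even (s (N - j))" using not_both sq by blast
    then show ?thesis
    proof cases
      case 1
      then have "g j = s j * s (N - j) - s (N - j)" using sq by (simp add: g_def q_def)
      then show ?thesis using aux 1 by simp
    next
      case 2
      then have "g j = s (N - j) * s j - s j" using sq NN by (simp add: g_def q_def)
      then show ?thesis using aux 2 by simp
    next
      case 3
      then have "g j = s j * s (N - j)" using sq by (simp add: g_def q_def)
      then show ?thesis using 3 mult_dvd_mono[of 2 "s j" 2 "s (N - j)"] by simp
    qed
  qed
  have "N - m = m" by (simp add: N_def)
  \<comment> \<open>If \<open>m\<close> were \<open>k^2\<close>, then \<open>N = k^2 + k^2\<close>.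
    So both corrections vanish at the middle.\<close>
  moreover have "\<not> (\<exists>k. m = k\<^sup>2)" using nsq by (auto simp: N_def mult_2)
  ultimately have "g m = (s m)\<^sup>2" by (simp add: g_def q_def power2_eq_square)
  moreover have "(\<Sum>j\<in>{0<..<N}. g j) = 2 * (\<Sum>j\<in>{0<..<m}. g j) + g m"
    unfolding N_def
    by (rule sum_symmetric_about_middle) (use \<open>m > 0\<close> in \<open>auto simp: g_def N_def\<close>)
  moreover have "4 dvd (\<Sum>j\<in>{0<..<m}. g j)"
    by (rule dvd_sum) (auto intro!: dvd_g simp: N_def)
  ultimately have "8 dvd (\<Sum>j\<in>{0<..<N}. g j) - (s m)\<^sup>2"
    by (auto elim!: dvdE)
  \<comment> \<open>Both corrections have the same total, whence the factor 2 before the sum over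
    squares.\<close>
  moreover have "(\<Sum>j\<in>{0<..<N}. q (N - j)) = (\<Sum>j\<in>{0<..<N}. q j)"
    by (rule sum.reindex_bij_witness[where i = "\<lambda>j. N - j" and j = "\<lambda>j. N - j"]) auto
  moreover have "(\<Sum>j\<in>{0<..<N}. q j) = (\<Sum>k | 1 \<le> k \<and> k\<^sup>2 < N. s (N - k\<^sup>2))"
    unfolding q_def by (rule sum_squares_below)
  ultimately show ?thesis
    by (simp add: g_def sum_subtractf sum.distrib s_def algebra_simps)
qed

theorem theorem1p4:
  fixes N m :: nat
  assumes "\<not> (\<exists>a b :: int. int N = a\<^sup>2 + b\<^sup>2)"
    and "N = 2 * m" and "odd m"
  shows "[real (nu2 N) + real (\<Sum>k | 1 \<le> k \<and> real k < sqrt (real N). sigma0 (N - k\<^sup>2))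
           + 1 / 2 * real (sigma1 N) = 0] (rmod 4)"
proof -
  have "m > 0" using assms(3) by (cases m) auto
  have nsq: "N \<noteq> a\<^sup>2 + b\<^sup>2" for a b :: nat
    using assms(1) by (metis of_nat_add of_nat_power)
  define S where "S = (\<Sum>k | 1 \<le> k \<and> k\<^sup>2 < N. sigma0 (N - k\<^sup>2))"
  define T where "T = (\<Sum>j\<in>{0<..<N}. sigma0 j * sigma0 (N - j))"
  have "real k < sqrt (real N) \<longleftrightarrow> k\<^sup>2 < N" for k
    by (metis of_nat_0_le_iff of_nat_less_iff of_nat_power real_less_rsqrt real_sqrt_less_iff
        real_sqrt_unique)
  then have S: "(\<Sum>k | 1 \<le> k \<and> real k < sqrt (real N). sigma0 (N - k\<^sup>2)) = S"
    by (simp add: S_def)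
  \<comment> \<open>If \<open>N - k^2\<close> were a square, \<open>N\<close> would be a sum of two
    squares.\<close>
  have "even (sigma0 (N - k\<^sup>2))" if "k\<^sup>2 < N" for k
    using odd_sigma0_iff[of "N - k\<^sup>2"] nsq[of k] that
    by (metis le_add_diff_inverse less_imp_le zero_less_diff)
  then have "even S" unfolding S_def by (intro dvd_sum) auto
  then obtain r where r: "S = 2 * r" by blast
  have "\<not> (\<exists>k. m = k\<^sup>2)" using nsq assms(2) by (auto simp: mult_2)
  then have "even (sigma0 m)" using odd_sigma0_iff[OF \<open>m > 0\<close>] by blast
  then obtain e where e: "sigma0 m = 2 * e" by blast
  \<comment> \<open>The term \<open>4 * e\<close> is \<open>sigma0 N = 2 * sigma0 m\<close>.\<close>
  have "2 * nu2 N + sigma1 N = T + 4 * e"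
    using nu2_convolution[of N] sigma0_double_odd[OF assms(3)] \<open>m > 0\<close> assms(2) e
    by (simp add: T_def)
  moreover have "8 dvd int T - 2 * int S - (int (sigma0 m))\<^sup>2"
    using convolution_mod_8[OF \<open>m > 0\<close>] nsq unfolding T_def S_def assms(2) by simp
  then obtain c where "int T = 8 * c + 2 * int S + 4 * (int e)\<^sup>2"
    by (auto simp: e algebra_simps power2_eq_square elim!: dvdE)
  moreover have "even ((int e)\<^sup>2 + int e)" by simp
  then obtain h where "(int e)\<^sup>2 + int e = 2 * h" by blast
  \<comment> \<open>The right side is \<open>8 * c + 4 * S + 4 * (e^2 + e)\<close>; the evenness of
    \<open>S\<close> and of \<open>e^2 + e\<close> lifts each 4 to 8. Halving then gives the modulus
    4.\<close>
  ultimately have "2 * int (nu2 N) + 2 * int S + int (sigma1 N) = 8 * (c + int r + h)"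
    using r by (simp add: algebra_simps)
  then have "real_of_int (2 * int (nu2 N) + 2 * int S + int (sigma1 N))
      = real_of_int (8 * (c + int r + h))" by (rule arg_cong)
  then have "real (nu2 N) + real S + 1 / 2 * real (sigma1 N) = 4 * of_int (c + int r + h)"
    by simp
  then show ?thesis unfolding S rcong_altdef
    by (intro exI[of _ "- (c + int r + h)"]) (simp add: algebra_simps)
qed

end
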